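(* Let $(J^{\mathcal F},\mathcal F)$ and $(J^{\mathcal G},\mathcal G)$ be two unimodal nonautonomous discrete dynamical systems and assume that both satisfy the limit property. Then $(J^{\mathcal F},\mathcal F)$ and $(J^{\mathcal G},\mathcal G)$ are topologically conjugate if and only if they have the same kneading sequence, i.e. $\mathbb V(\mathcal F)=\mathbb V(\mathcal G)$.
   Context: Unimodal map: for a compact interval $J=[a,b]$ with $a<b$, a unimodal map is a continuous map $f:J\to J$ with $f(a)=f(b)=a$ for which there is a point $c^f\in(a,b)$ (the turning point) such that $f$ is strictly increasing on $[a,c^f]$ and strictly decreasing on $[c^f,b]$. UNDS: a unimodal nonautonomous discrete dynamical system (UNDS) $(J^{\mathcal F},\mathcal F)$ consists of an interval $J^{\mathcal F}=[a^{\mathcal F},b^{\mathcal F}]$ and a sequence $\mathcal F=(f_n)_{n\ge1}$ of unimodal maps $f_n:J^{\mathcal F}\to J^{\mathcal F}$ (so $f_n(a^{\mathcal F})=f_n(b^{\mathcal F})=a^{\mathcal F}$), with turning points $c_n^{\mathcal F}\in(a^{\mathcal F},b^{\mathcal F})$. Write $f_n^{\ell}:=f_{n+\ell-1}\circ\cdots\circ f_n$ for $\ell\ge1$ and $f_n^0:=\mathrm{id}$. The same notation is used for $\mathcal G=(g_n)_{n\ge1}$ on $J^{\mathcal G}=[a^{\mathcal G},b^{\mathcal G}]$ with turning points $c_n^{\mathcal G}$. Kneading sequence: for $n\ge1$ and $x\in J^{\mathcal F}$, the address $i_{\mathcal F,n}(x)$ is the letter $L$ if $x\in[a^{\mathcal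 F},c_n^{\mathcal F})$, the letter $c_n^{\mathcal F}$ if $x=c_n^{\mathcal F}$, and the letter $R$ if $x\in(c_n^{\mathcal F},b^{\mathcal F}]$. The itinerary of $x$ on level $n$ is $I_{\mathcal F,n}(x)=(i_{\mathcal F,n+\ell}(f_n^{\ell}(x)))_{\ell\ge0}$. The kneading sequence is $\mathbb V(\mathcal F)=\{\mathbb V_n^{\mathcal F}\}_{n\ge1}$ with $\mathbb V_n^{\mathcal F}:=I_{\mathcal F,n}(c_n^{\mathcal F})$. Equality $\mathbb V(\mathcal F)=\mathbb V(\mathcal G)$ is understood after identifying the alphabets by $L\leftrightarrow L$, $R\leftrightarrow R$, $c_n^{\mathcal F}\leftrightarrow c_n^{\mathcal G}$ for every $n$. Topological conjugacy: $(J^{\mathcal F},\mathcal F)$ and $(J^{\mathcal G},\mathcal G)$ are topologically conjugate if there is a sequence $(h_n)_{n\ge1}$ of order preserving homeomorphisms $h_n:J^{\mathcal F}\to J^{\mathcal G}$ such that both families $(h_n)_{n\ge1}$ and $(h_n^{-1})_{n\ge1}$ are equicontinuous and $h_{n+1}\circ f_n=g_n\circ h_n$ for every $n\ge1$. Limit property: set $\mathscr C_n(\mathcal F)=\{x\in J^{\mathcal F}:\exists\,\ell\ge0 \text{ with } f_n^{\ell}(x)=c_{n+\ell}^{\mathcal F}\}$, and for a single unimodal map $f$ set $\mathscr C(f)=\{x:\exists\,\ell\ge0\text{ with } f^{\ell}(x)=c^f\}$. The UNDS $(J^{\mathcal F},\mathcal F)$ satisfies the limit property if there is a unimodal map $f:J^{\mathcal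 F}\to J^{\mathcal F}$ whose turning point $c^f$ is not periodic (i.e. $f^m(c^f)\ne c^f$ for all $m\ge1$), such that $f_n$ converges uniformly to $f$, $\mathscr C_n(\mathcal F)$ is dense in $J^{\mathcal F}$ for all $n\ge1$, and $\mathscr C(f)$ is dense in $J^{\mathcal F}$. *)

theory Defs
  imports "HOL-Analysis.Analysis"
begin

text \<open>
  Maps of \<open>J = [a, b]\<close> are total functions on the reals of which only the values on \<open>{a..b}\<close>
  matter. Sequences indexed by \<open>n \<ge> 1\<close> are total functions on the naturals whose value
  at \<open>0\<close> is ignored.
\<close>

definition is_turning_point :: "real \<Rightarrow> real \<Rightarrow> (real \<Rightarrow> real) \<Rightarrow> real \<Rightarrow> bool" where
  "is_turning_point a b f c \<longleftrightarrow>
     c \<in> {a<..<b} \<and> strict_mono_on {a..c} f \<and> strict_antimono_on {c..b} f"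

definition unimodal :: "real \<Rightarrow> real \<Rightarrow> (real \<Rightarrow> real) \<Rightarrow> bool" where
  "unimodal a b f \<longleftrightarrow>
     a < b \<and> continuous_on {a..b} f \<and> f \<in> {a..b} \<rightarrow> {a..b} \<and> f a = a \<and> f b = a \<and>
     (\<exists>c. is_turning_point a b f c)"

definition turning_point :: "real \<Rightarrow> real \<Rightarrow> (real \<Rightarrow> real) \<Rightarrow> real" where
  "turning_point a b f = (THE c. is_turning_point a b f c)"

lemma is_turning_point_unique:
  assumes "is_turning_point a b f c" and "is_turning_point a b f d"
  shows "c = d"
proof -
  have False if c: "is_turning_point a b f c" and d: "is_turning_point a b f d" and "c < d" for c d
  proof -
    have "f c < f d"
      using c d \<open>c < d\<close> by (auto simp: is_turning_point_def intro: strict_mono_onD)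
    moreover have "f d < f c"
      using c d \<open>c < d\<close> by (auto simp: is_turning_point_def monotone_on_def)
    ultimately show False by simp
  qed
  with assms show ?thesis by (meson linorder_neqE)
qed

lemma turning_point_eq: "is_turning_point a b f c \<Longrightarrow> turning_point a b f = c"
  unfolding turning_point_def by (blast intro: is_turning_point_unique)

lemma is_turning_point_turning_point:
  "unimodal a b f \<Longrightarrow> is_turning_point a b f (turning_point a b f)"
  by (auto simp: unimodal_def turning_point_eq)

definition UNDS :: "real \<Rightarrow> real \<Rightarrow> (nat \<Rightarrow> real \<Rightarrow> real) \<Rightarrow> bool" where
  "UNDS a b F \<longleftrightarrow> a < b \<and> (\<forall>n\<ge>1. unimodal a b (F n))"

text \<open>\<open>nds_iter F n l\<close> is \<open>F (n + l - 1) \<circ> \<dots> \<circ> F n\<close>.\<close>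

primrec nds_iter :: "(nat \<Rightarrow> 'a \<Rightarrow> 'a) \<Rightarrow> nat \<Rightarrow> nat \<Rightarrow> 'a \<Rightarrow> 'a" where
  "nds_iter F n 0 = id"
| "nds_iter F n (Suc l) = F (n + l) \<circ> nds_iter F n l"

text \<open>
  The letter \<open>C n\<close> stands for the turning point on level \<open>n\<close>. Using the same letter for every
  system builds in the identification of the turning points of two systems on each level.
\<close>

datatype letter = L | C nat | R

definition address :: "real \<Rightarrow> real \<Rightarrow> (nat \<Rightarrow> real \<Rightarrow> real) \<Rightarrow> nat \<Rightarrow> real \<Rightarrow> letter" where
  "address a b F n x =
     (if x < turning_point a b (F n) then L
      else if x = turning_point a b (F n) then C n
      else R)"

definition itinerary :: "real \<Rightarrow> real \<Rightarrow> (nat \<Rightarrow> real \<Rightarrow> real) \<Rightarrow> nat \<Rightarrow> real \<Rightarrow> nat \<Rightarrow> letter" where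
  "itinerary a b F n x = (\<lambda>l. address a b F (n + l) (nds_iter F n l x))"

definition kneading_sequence :: "real \<Rightarrow> real \<Rightarrow> (nat \<Rightarrow> real \<Rightarrow> real) \<Rightarrow> nat \<Rightarrow> nat \<Rightarrow> letter" where
  "kneading_sequence a b F = (\<lambda>n\<in>{1..}. itinerary a b F n (turning_point a b (F n)))"

definition equicontinuous_on ::
  "'i set \<Rightarrow> 'a::metric_space set \<Rightarrow> ('i \<Rightarrow> 'a \<Rightarrow> 'b::metric_space) \<Rightarrow> bool" where
  "equicontinuous_on I S h \<longleftrightarrow>
     (\<forall>x\<in>S. \<forall>e>0. \<exists>d>0. \<forall>i\<in>I. \<forall>y\<in>S. dist y x < d \<longrightarrow> dist (h i y) (h i x) < e)"

definition topologically_conjugate ::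
  "real \<Rightarrow> real \<Rightarrow> (nat \<Rightarrow> real \<Rightarrow> real) \<Rightarrow> real \<Rightarrow> real \<Rightarrow> (nat \<Rightarrow> real \<Rightarrow> real) \<Rightarrow> bool" where
  "topologically_conjugate a b F a' b' G \<longleftrightarrow>
     (\<exists>h k. (\<forall>n\<ge>1. homeomorphism {a..b} {a'..b'} (h n) (k n) \<and> strict_mono_on {a..b} (h n)) \<and>
        equicontinuous_on {1..} {a..b} h \<and>
        equicontinuous_on {1..} {a'..b'} k \<and>
        (\<forall>n\<ge>1. \<forall>x\<in>{a..b}. h (Suc n) (F n x) = G n (h n x)))"

definition precritical :: "real \<Rightarrow> real \<Rightarrow> (nat \<Rightarrow> real \<Rightarrow> real) \<Rightarrow> nat \<Rightarrow> real set" where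
  "precritical a b F n =
     {x \<in> {a..b}. \<exists>l. nds_iter F n l x = turning_point a b (F (n + l))}"

definition precritical_map :: "real \<Rightarrow> real \<Rightarrow> (real \<Rightarrow> real) \<Rightarrow> real set" where
  "precritical_map a b f = {x \<in> {a..b}. \<exists>l. (f ^^ l) x = turning_point a b f}"

definition limit_property :: "real \<Rightarrow> real \<Rightarrow> (nat \<Rightarrow> real \<Rightarrow> real) \<Rightarrow> bool" where
  "limit_property a b F \<longleftrightarrow>
     (\<exists>f. unimodal a b f \<and>
        (\<forall>m\<ge>1. (f ^^ m) (turning_point a b f) \<noteq> turning_point a b f) \<and>
        uniform_limit {a..b} F f sequentially \<and>
        (\<forall>n\<ge>1. {a..b} \<subseteq> closure (precritical a b F n)) \<and>
        {a..b} \<subseteq> closure (precritical_map a b f))"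

end

theory Submission
  imports Defs
begin

text \<open>
  An increasing homeomorphism \<open>h n\<close> with \<open>h (n + 1) \<circ> F n = G n \<circ> h n\<close> turns the two monotone
  branches of \<open>F n\<close> into those of \<open>G n\<close>. It therefore sends turning points to turning points and
  preserves itineraries (\<open>h_crit\<close>, \<open>side_h\<close>), in particular those of the turning points. So
  conjugate systems have the same kneading sequence.

  For the converse, encode an itinerary by signs: \<open>side n l x\<close> is \<open>-1\<close>, \<open>0\<close> or \<open>1\<close> according to
  whether the \<open>l\<close>-th iterate of \<open>x\<close> is left of, at, or right of the turning point. While two orbits
  stay on common sides, the order between them is governed by the product of the negated signs
  (\<open>sgn_iter_diff\<close>). Hence the order of two points can be read off from their itineraries, by a
  rule that is the same in both systems (\<open>matches_order\<close>). The conjugacy \<open>h n\<close> sends \<open>x\<close> to the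
  point of the other system with the same itinerary. It is well defined and strictly increasing
  because precritical points are dense, so that itineraries determine points (\<open>side_injective\<close>). For
  precritical \<open>x\<close> the partner is found by pulling back along branches; the equality of the kneading
  sequences says that the maxima of \<open>F n\<close> and \<open>G n\<close> are partners, hence that the necessary preimage
  exists (\<open>precritical_has_match\<close>). Every other \<open>x\<close> is approximated by precritical points
  (\<open>has_match\<close>). An increasing bijection of intervals is a homeomorphism, and the conjugacy equation
  holds because both of its sides have the same itinerary.

  Equicontinuity holds for every such family \<open>h\<close>, and is where convergence enters. Let \<open>f\<close> and
  \<open>g\<close> be the limits of \<open>F\<close> and \<open>G\<close>. Every interval in the target contains precritical
  points of \<open>g\<close> with two different hitting times \<open>l \<noteq> m\<close>, and for large \<open>n\<close> also points that \<open>G\<close>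
  takes from level \<open>n\<close> to turning points after \<open>l\<close> and \<open>m\<close> steps (\<open>two_hitting_times\<close>). The inverse of
  \<open>h n\<close> sends them to points that hit turning points of \<open>F\<close> after \<open>l\<close> and \<open>m\<close> steps. Two such points
  keep a distance that is bounded below independently of \<open>n\<close>: otherwise some orbit of \<open>f\<close> would visit
  the turning point of \<open>f\<close> at both times, and this point would be periodic (\<open>hits_separated\<close>).
  So \<open>h n\<close> cannot stretch short intervals over a given length (\<open>preimage_of_cell_wide\<close>). The
  argument for the inverses is the same with the two systems exchanged.
\<close>

section \<open>Sides and orientation of iterates\<close>

locale unimodal_system =
  fixes a b :: real and F :: "nat \<Rightarrow> real \<Rightarrow> real"
  assumes unds: "UNDS a b F"
begin

abbreviation crit :: "nat \<Rightarrow> real" where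
  "crit n \<equiv> turning_point a b (F n)"

definition side :: "nat \<Rightarrow> nat \<Rightarrow> real \<Rightarrow> real" where
  "side n l x = sgn (nds_iter F n l x - crit (n + l))"

definition orient :: "nat \<Rightarrow> nat \<Rightarrow> real \<Rightarrow> real" where
  "orient n l x = (\<Prod>i<l. - side n i x)"

lemma a_less_b: "a < b"
  using unds by (simp add: UNDS_def)

lemma unimodal_F: "n \<ge> 1 \<Longrightarrow> unimodal a b (F n)"
  using unds by (simp add: UNDS_def)

lemma
  assumes "n \<ge> 1"
  shows crit_in: "crit n \<in> {a<..<b}"
    and F_incr: "strict_mono_on {a..crit n} (F n)"
    and F_decr: "strict_antimono_on {crit n..b} (F n)"
  using is_turning_point_turning_point[OF unimodal_F[OF assms]]
  by (auto simp: is_turning_point_def)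

lemma
  assumes "n \<ge> 1"
  shows F_cont: "continuous_on {a..b} (F n)"
    and F_maps: "x \<in> {a..b} \<Longrightarrow> F n x \<in> {a..b}"
    and F_a: "F n a = a" and F_b: "F n b = a"
  using unimodal_F[OF assms] by (auto simp: unimodal_def)

lemma F_less_max:
  assumes "n \<ge> 1" "x \<in> {a..b}" "x \<noteq> crit n"
  shows "F n x < F n (crit n)"
  using crit_in[OF assms(1)] strict_mono_onD[OF F_incr[OF assms(1)], of x "crit n"]
    monotone_onD[OF F_decr[OF assms(1)], of "crit n" x] assms(2,3)
  by (cases "x < crit n") auto

lemma iter_maps: "n \<ge> 1 \<Longrightarrow> x \<in> {a..b} \<Longrightarrow> nds_iter F n l x \<in> {a..b}"
proof (induction l)
  case (Suc l)
  then show ?case using F_maps[of "n + l" "nds_iter F n l x"] by simp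
qed simp

lemma iter_cont: "n \<ge> 1 \<Longrightarrow> continuous_on {a..b} (nds_iter F n l)"
proof (induction l)
  case (Suc l)
  have "continuous_on (nds_iter F n l ` {a..b}) (F (n + l))"
    by (rule continuous_on_subset[OF F_cont]) (use Suc.prems iter_maps in auto)
  with continuous_on_compose[OF Suc.IH[OF Suc.prems] this] show ?case by simp
qed (simp add: id_def)

lemma iter_shift: "nds_iter F n (Suc l) x = nds_iter F (Suc n) l (F n x)"
  by (induction l) auto

lemma side_0: "side n 0 x = sgn (x - crit n)"
  by (simp add: side_def)

lemma side_shift: "side n (Suc l) x = side (Suc n) l (F n x)"
  unfolding side_def iter_shift by simp

lemma orient_cong: "(\<And>i. i < l \<Longrightarrow> side n i x = side n i y) \<Longrightarrow> orient n l x = orient n l y"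
  by (simp add: orient_def)

lemma sgn_F_diff:
  assumes "n \<ge> 1" "u \<in> {a..b}" "v \<in> {a..b}" "sgn (u - crit n) = sgn (v - crit n)"
  shows "sgn (F n v - F n u) = - sgn (u - crit n) * sgn (v - u)"
proof -
  note incr = strict_mono_onD[OF F_incr[OF assms(1)]]
  note decr = monotone_onD[OF F_decr[OF assms(1)]]
  consider "u < crit n" "v < crit n" | "u = crit n" "v = crit n" | "u > crit n" "v > crit n"
    using assms(4) by (auto simp: sgn_if split: if_splits)
  then show ?thesis
  proof cases
    case 1
    then show ?thesis using incr[of u v] incr[of v u] assms(2,3) by (cases u v rule: linorder_cases) auto
  next
    case 3
    then show ?thesis using decr[of u v] decr[of v u] assms(2,3) by (cases u v rule: linorder_cases) auto
  qed auto
qed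

text \<open>
  A unimodal map preserves order on the left of its turning point and reverses it on the right, so
  \<open>- side\<close> is the sign by which each step acts. At the turning point the factor is \<open>0\<close>, which is
  also correct because two such points coincide. Thus orbits that hit a turning point obey the
  same formula as all others.
\<close>

lemma sgn_iter_diff:
  assumes "n \<ge> 1" "x \<in> {a..b}" "y \<in> {a..b}" "\<And>i. i < l \<Longrightarrow> side n i x = side n i y"
  shows "sgn (nds_iter F n l y - nds_iter F n l x) = orient n l x * sgn (y - x)"
  using assms(4)
proof (induction l)
  case 0
  then show ?case by (simp add: orient_def)
next
  case (Suc l)
  have "sgn (nds_iter F n (Suc l) y - nds_iter F n (Suc l) x)
      = - side n l x * sgn (nds_iter F n l y - nds_iter F n l x)"
    using sgn_F_diff[of "n + l" "nds_iter F n l x" "nds_iter F n l y"] assms(1-3) iter_maps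
      Suc.prems[of l] by (simp add: side_def)
  then show ?case using Suc by (simp add: orient_def)
qed

text \<open>
  As long as the three orbits share their sides, each iterate of \<open>p\<close> lies between those of \<open>x\<close> and
  \<open>y\<close>, in one order or the other, so a side shared by these two is also the side of \<open>p\<close>.
\<close>

lemma side_convex:
  assumes "n \<ge> 1" "x \<in> {a..b}" "y \<in> {a..b}" "x \<le> p" "p \<le> y"
    and agree: "\<And>i. i \<le> l \<Longrightarrow> side n i x = side n i y"
  shows "i \<le> l \<Longrightarrow> side n i p = side n i x"
proof (induction i rule: less_induct)
  case (less i)
  have p: "p \<in> {a..b}" using assms by auto
  have "sgn (nds_iter F n i p - nds_iter F n i x) = orient n i x * sgn (p - x)"
    by (rule sgn_iter_diff) (use assms p less in auto)
  moreover have "sgn (nds_iter F n i y - nds_iter F n i p) = orient n i p * sgn (y - p)"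
    by (rule sgn_iter_diff) (use assms p less in auto)
  moreover have "orient n i p = orient n i x"
    by (rule orient_cong) (use less in auto)
  ultimately have "nds_iter F n i x \<le> nds_iter F n i p \<and> nds_iter F n i p \<le> nds_iter F n i y \<or>
      nds_iter F n i y \<le> nds_iter F n i p \<and> nds_iter F n i p \<le> nds_iter F n i x"
    using \<open>x \<le> p\<close> \<open>p \<le> y\<close> by (auto simp: sgn_if split: if_splits)
  moreover have "side n i x = side n i y" using agree less.prems by simp
  ultimately show ?case by (auto simp: side_def sgn_if split: if_splits)
qed

text \<open>If the orbit has not yet met a turning point, continuity keeps it on its sides.\<close>

lemma eventually_side_eq:
  assumes "n \<ge> 1" "x \<in> {a..b}" "\<And>i. i < l \<Longrightarrow> side n i x \<noteq> 0"
  shows "\<forall>\<^sub>F z in at x within {a..b}. \<forall>i\<in>{..<l}. side n i z = side n i x"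
proof (rule eventually_ball_finite; clarsimp?)
  fix i assume "i < l"
  have lim: "((\<lambda>z. nds_iter F n i z) \<longlongrightarrow> nds_iter F n i x) (at x within {a..b})"
    using iter_cont[OF assms(1)] assms(2) by (simp add: continuous_on)
  have "nds_iter F n i x \<noteq> crit (n + i)"
    using assms(3)[OF \<open>i < l\<close>] by (auto simp: side_def)
  then consider "nds_iter F n i x < crit (n + i)" | "nds_iter F n i x > crit (n + i)"
    by linarith
  then show "\<forall>\<^sub>F z in at x within {a..b}. side n i z = side n i x"
  proof cases
    case 1
    from order_tendstoD(2)[OF lim this] show ?thesis
      by eventually_elim (use 1 in \<open>simp add: side_def\<close>)
  next
    case 2
    from order_tendstoD(1)[OF lim this] show ?thesis
      by eventually_elim (use 2 in \<open>simp add: side_def\<close>)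
  qed
qed

lemma side_eq_nearby:
  assumes "n \<ge> 1" "x \<in> {a<..<b}" "\<And>i. i < l \<Longrightarrow> side n i x \<noteq> 0" "u < x" "x < v"
  obtains u' v' where "max a u < u'" "u' < x" "x < v'" "v' < min b v"
    and "\<And>z i. u' \<le> z \<Longrightarrow> z \<le> v' \<Longrightarrow> i < l \<Longrightarrow> side n i z = side n i x"
proof -
  have x: "x \<in> {a..b}" using assms(2) by auto
  obtain d where d: "d > 0"
    "\<And>z. z \<in> {a..b} \<Longrightarrow> z \<noteq> x \<Longrightarrow> dist z x < d \<Longrightarrow> \<forall>i\<in>{..<l}. side n i z = side n i x"
    using eventually_side_eq[OF assms(1) x assms(3)] unfolding eventually_at by blast
  obtain u' where u': "max (max a u) (x - d) < u'" "u' < x"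
    using dense[of "max (max a u) (x - d)" x] assms d by auto
  obtain v' where v': "v' < min (min b v) (x + d)" "x < v'"
    using dense[of x "min (min b v) (x + d)"] assms d by auto
  show ?thesis
  proof (rule that[of u' v'])
    fix z i assume "u' \<le> z" "z \<le> v'" "i < l"
    then show "side n i z = side n i x"
      using d(2)[of z] u' v' by (cases "z = x") (auto simp: dist_real_def)
  qed (use u' v' in auto)
qed

lemma precritical_iff_side:
  "p \<in> precritical a b F n \<longleftrightarrow> p \<in> {a..b} \<and> (\<exists>l. side n l p = 0)"
  by (simp add: precritical_def side_def sgn_0_0)

lemma precritical_between:
  assumes "{a..b} \<subseteq> closure (precritical a b F n)" "a \<le> u" "u < v" "v \<le> b"
  obtains p where "p \<in> precritical a b F n" "u < p" "p < v"
proof -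
  have "(u + v) / 2 \<in> {u<..<v}" "(u + v) / 2 \<in> closure (precritical a b F n)"
    using assms by auto
  then have "{u<..<v} \<inter> precritical a b F n \<noteq> {}"
    by (metis IntI empty_iff open_Int_closure_eq_empty open_greaterThanLessThan)
  then show ?thesis using that by auto
qed

lemma orient_nonzero: "(\<And>i. i < l \<Longrightarrow> side n i x \<noteq> 0) \<Longrightarrow> orient n l x \<noteq> 0"
  by (simp add: orient_def)

text \<open>
  A first hitting time has nonzero orientation, so only one of the points that share a
  past up to it can hit.
\<close>

lemma first_hit_unique:
  assumes "n \<ge> 1" "x \<in> {a..b}" "y \<in> {a..b}" "\<And>i. i < l \<Longrightarrow> side n i x = side n i y"
    and "\<And>i. i < l \<Longrightarrow> side n i x \<noteq> 0" "side n l x = 0" "side n l y = 0"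
  shows "x = y"
proof -
  have "sgn (nds_iter F n l y - nds_iter F n l x) = 0"
    using assms(6,7) by (auto simp: side_def sgn_if split: if_splits)
  then show ?thesis
    using sgn_iter_diff[OF assms(1-4)] orient_nonzero[OF assms(5)] by (auto simp: sgn_if split: if_splits)
qed

text \<open>
  A precritical point between two points with the same itinerary would have that itinerary too,
  by convexity. So it would hit a turning point for the first time together with both of them.
\<close>

lemma side_injective:
  assumes "n \<ge> 1" and dense: "{a..b} \<subseteq> closure (precritical a b F n)"
    and "x \<in> {a..b}" "y \<in> {a..b}" "\<And>l. side n l x = side n l y"
  shows "x = y"
proof -
  have False if xy: "x \<in> {a..b}" "y \<in> {a..b}" "\<And>l. side n l x = side n l y" "x < y" for x y
  proof -
    obtain p where p: "p \<in> precritical a b F n" "x < p" "p < y"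
      using precritical_between[OF dense, of x y] xy by auto
    have p_x: "side n l p = side n l x" for l
      using side_convex[OF assms(1) xy(1,2), of p l l] p xy(3) by auto
    obtain l where l: "side n l p = 0" "\<And>i. i < l \<Longrightarrow> side n i p \<noteq> 0"
      using p(1) exists_least_iff[of "\<lambda>l. side n l p = 0"] by (auto simp: precritical_iff_side)
    have "p = x"
      by (rule first_hit_unique[of n _ _ l]) (use assms(1) p p_x l xy(1) in \<open>auto simp: precritical_iff_side\<close>)
    with p show False by simp
  qed
  with assms(3-5) show ?thesis by (metis linorder_neqE)
qed

lemma side_a: "n \<ge> 1 \<Longrightarrow> side n l a = -1"
proof -
  assume "n \<ge> 1"
  then have "nds_iter F n l a = a" using F_a by (induction l) auto
  then show ?thesis using crit_in[of "n + l"] \<open>n \<ge> 1\<close> by (simp add: side_def)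
qed

lemma side_b: "n \<ge> 1 \<Longrightarrow> side n l b = (if l = 0 then 1 else -1)"
  using crit_in[of n] by (cases l) (simp_all add: side_0 side_shift F_b side_a)

end

lemma itinerary_eq_iff_side_eq:
  assumes "unimodal_system a b F" "unimodal_system a' b' G"
  shows "itinerary a b F n x = itinerary a' b' G n y \<longleftrightarrow>
    (\<forall>l. unimodal_system.side a b F n l x = unimodal_system.side a' b' G n l y)"
proof -
  have "address a b F (n + l) (nds_iter F n l x) = address a' b' G (n + l) (nds_iter G n l y) \<longleftrightarrow>
      unimodal_system.side a b F n l x = unimodal_system.side a' b' G n l y" for l
    by (simp add: address_def unimodal_system.side_def assms sgn_if)
  then show ?thesis by (simp add: itinerary_def fun_eq_iff)
qed

section \<open>Points with the same sides in two systems\<close>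

locale system_pair =
  F: unimodal_system a b F + G: unimodal_system a' b' G
  for a b F a' b' G
begin

definition matches :: "nat \<Rightarrow> real \<Rightarrow> real \<Rightarrow> bool" where
  "matches n x y \<longleftrightarrow> x \<in> {a..b} \<and> y \<in> {a'..b'} \<and> (\<forall>l. F.side n l x = G.side n l y)"

lemma matches_shift: "n \<ge> 1 \<Longrightarrow> matches n x y \<Longrightarrow> matches (Suc n) (F n x) (G n y)"
  unfolding matches_def F.side_shift[symmetric] G.side_shift[symmetric]
  using F.F_maps G.F_maps by blast

text \<open>
  At the first level where the sides of the two points differ, their order is read off from these
  sides and from the orientation of the common past, which are the same data in both systems.
\<close>

lemma matches_order:
  assumes "n \<ge> 1" "matches n x1 y1" "matches n x2 y2" "F.side n l x1 \<noteq> F.side n l x2"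
  shows "sgn (x2 - x1) = sgn (y2 - y1)"
proof -
  obtain l where l: "F.side n l x1 \<noteq> F.side n l x2" "\<And>i. i < l \<Longrightarrow> F.side n i x1 = F.side n i x2"
    using assms(4) exists_least_iff[of "\<lambda>l. F.side n l x1 \<noteq> F.side n l x2"] by auto
  have F: "sgn (nds_iter F n l x2 - nds_iter F n l x1) = F.orient n l x1 * sgn (x2 - x1)"
    by (rule F.sgn_iter_diff) (use assms l in \<open>auto simp: matches_def\<close>)
  have G: "sgn (nds_iter G n l y2 - nds_iter G n l y1) = G.orient n l y1 * sgn (y2 - y1)"
    by (rule G.sgn_iter_diff) (use assms l in \<open>auto simp: matches_def\<close>)
  have "F.orient n l x1 = G.orient n l y1"
    using assms(2) by (simp add: matches_def F.orient_def G.orient_def)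
  moreover have "sgn (nds_iter F n l x2 - nds_iter F n l x1) = sgn (F.side n l x2 - F.side n l x1)"
    using l(1) by (auto simp: F.side_def sgn_if split: if_splits)
  moreover have "sgn (nds_iter G n l y2 - nds_iter G n l y1) = sgn (F.side n l x2 - F.side n l x1)"
    using l(1) assms(2,3) by (auto simp: matches_def G.side_def sgn_if split: if_splits)
  moreover have "sgn (F.side n l x2 - F.side n l x1) \<noteq> 0"
    using l(1) by (simp add: sgn_if)
  ultimately show ?thesis using F G by (metis mult_cancel_left mult_zero_left)
qed

end

locale same_kneading = system_pair +
  assumes dense_F: "\<And>n. n \<ge> 1 \<Longrightarrow> {a..b} \<subseteq> closure (precritical a b F n)"
    and dense_G: "\<And>n. n \<ge> 1 \<Longrightarrow> {a'..b'} \<subseteq> closure (precritical a' b' G n)"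
    and crit_matches: "\<And>n. n \<ge> 1 \<Longrightarrow> matches n (F.crit n) (G.crit n)"
begin

lemma matches_less:
  assumes "n \<ge> 1" "matches n x1 y1" "matches n x2 y2" "x1 < x2"
  shows "y1 < y2"
proof -
  obtain l where "F.side n l x1 \<noteq> F.side n l x2"
    using F.side_injective[OF assms(1) dense_F, of x1 x2] assms by (auto simp: matches_def)
  from matches_order[OF assms(1-3) this] show ?thesis
    using assms(4) by (auto simp: sgn_if split: if_splits)
qed

text \<open>
  Pulling a match back along \<open>F n\<close> requires that its partner lies below the maximum of \<open>G n\<close>. The
  two maxima match because the kneading sequences agree, so the comparison carries over.
\<close>

lemma precritical_has_match:
  assumes "n \<ge> 1" "x \<in> {a..b}" "F.side n l x = 0"
  shows "\<exists>y. matches n x y"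
  using assms
proof (induction l arbitrary: n x)
  case 0
  then have "x = F.crit n" by (auto simp: F.side_0 sgn_if split: if_splits)
  then show ?case using crit_matches 0 by blast
next
  case (Suc l)
  show ?case
  proof (cases "x = F.crit n")
    case True
    then show ?thesis using crit_matches Suc by blast
  next
    case False
    obtain z where z: "matches (Suc n) (F n x) z"
      using Suc.IH[of "Suc n" "F n x"] Suc.prems F.F_maps by (auto simp: F.side_shift)
    have "matches (Suc n) (F n (F.crit n)) (G n (G.crit n))"
      using matches_shift crit_matches Suc.prems by blast
    with z have z_less: "z < G n (G.crit n)"
      using matches_less F.F_less_max[OF Suc.prems(1,2) False] by force
    have z_in: "a' \<le> z" using z by (simp add: matches_def)
    note cr = G.crit_in[OF Suc.prems(1)]
    have "\<exists>y\<in>{a'..b'}. G n y = z \<and> sgn (y - G.crit n) = sgn (x - F.crit n)"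
    proof (cases "x < F.crit n")
      case True
      have "continuous_on {a'..G.crit n} (G n)"
        by (rule continuous_on_subset[OF G.F_cont[OF Suc.prems(1)]]) (use cr in auto)
      then obtain y where "a' \<le> y" "y \<le> G.crit n" "G n y = z"
        using IVT'[of "G n" a' z "G.crit n"] z_in z_less cr G.F_a[OF Suc.prems(1)] by auto
      with z_less have "y < G.crit n" "y \<in> {a'..b'}" "G n y = z"
        using cr by (auto simp: order.order_iff_strict)
      then show ?thesis using True by (intro bexI[of _ y]) auto
    next
      case F: False
      have "continuous_on {G.crit n..b'} (G n)"
        by (rule continuous_on_subset[OF G.F_cont[OF Suc.prems(1)]]) (use cr in auto)
      then obtain y where "G.crit n \<le> y" "y \<le> b'" "G n y = z"
        using IVT2'[of "G n" b' z "G.crit n"] z_in z_less cr G.F_b[OF Suc.prems(1)] by auto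
      with z_less have "y > G.crit n" "y \<in> {a'..b'}" "G n y = z"
        using cr by (auto simp: order.order_iff_strict)
      then show ?thesis using F False by (intro bexI[of _ y]) auto
    qed
    then obtain y where y: "y \<in> {a'..b'}" "G n y = z" "sgn (y - G.crit n) = sgn (x - F.crit n)"
      by blast
    have "F.side n i x = G.side n i y" for i
      using y z by (cases i) (auto simp: F.side_0 G.side_0 F.side_shift G.side_shift matches_def)
    then show ?thesis using y Suc.prems by (auto simp: matches_def)
  qed
qed

text \<open>
  A point whose orbit avoids the turning points is squeezed, for each length \<open>l\<close>, between precritical
  points with the same first \<open>l\<close> sides. The supremum of the partners of the points on
  its left is squeezed in the same way in the other system, for all \<open>l\<close> at once. The endpoints, which
  cannot be approximated from both sides, match by inspection.
\<close>

lemma has_match: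
  assumes "n \<ge> 1" "x \<in> {a..b}"
  shows "\<exists>y. matches n x y"
proof -
  consider "\<exists>l. F.side n l x = 0" | "x = a" | "x = b"
    | "x \<in> {a<..<b}" "\<And>l. F.side n l x \<noteq> 0"
    using assms by force
  then show ?thesis
  proof cases
    case 1
    then show ?thesis using precritical_has_match assms by blast
  next
    case 2
    then have "matches n x a'"
      using F.side_a G.side_a F.a_less_b G.a_less_b assms by (auto simp: matches_def)
    then show ?thesis ..
  next
    case 3
    then have "matches n x b'"
      using F.side_b G.side_b F.a_less_b G.a_less_b assms by (auto simp: matches_def)
    then show ?thesis ..
  next
    case 4
    define Q where "Q = {q. \<exists>p. p < x \<and> matches n p q}"
    have squeeze: "\<exists>p1 q1 p2 q2. p1 < x \<and> x < p2 \<and> matches n p1 q1 \<and> matches n p2 q2 \<and>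
      (\<forall>i<l. F.side n i p1 = F.side n i x \<and> F.side n i p2 = F.side n i x)" for l
    proof -
      obtain u v where uv: "a < u" "u < x" "x < v" "v < b"
        and agree: "\<And>z i. u \<le> z \<Longrightarrow> z \<le> v \<Longrightarrow> i < l \<Longrightarrow> F.side n i z = F.side n i x"
        using F.side_eq_nearby[OF assms(1) 4, where u = a and v = b and l = l] 4(1) by auto
      obtain p1 where p1: "p1 \<in> precritical a b F n" "u < p1" "p1 < x"
        using F.precritical_between[OF dense_F[OF assms(1)], of u x] uv by auto
      obtain p2 where p2: "p2 \<in> precritical a b F n" "x < p2" "p2 < v"
        using F.precritical_between[OF dense_F[OF assms(1)], of x v] uv by auto
      obtain q1 q2 where "matches n p1 q1" "matches n p2 q2"
        using precritical_has_match[OF assms(1)] p1(1) p2(1)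
        unfolding F.precritical_iff_side by blast
      with p1 p2 agree[of p1] agree[of p2] uv show ?thesis by force
    qed
    have Q_less: "q < q2" if "q \<in> Q" "x < p2" "matches n p2 q2" for q p2 q2
      using that matches_less[OF assms(1)] by (fastforce simp: Q_def)
    have bdd: "bdd_above Q"
      by (rule bdd_aboveI[of _ b']) (auto simp: Q_def matches_def)
    define y where "y = Sup Q"
    have side_y: "y \<in> {a'..b'} \<and> G.side n l y = F.side n l x" for l
    proof -
      obtain p1 q1 p2 q2 where pq: "p1 < x" "x < p2" "matches n p1 q1" "matches n p2 q2"
        and eq: "\<And>i. i < Suc l \<Longrightarrow> F.side n i p1 = F.side n i x \<and> F.side n i p2 = F.side n i x"
        using squeeze[of "Suc l"] by blast
      have "q1 \<in> Q" using pq by (auto simp: Q_def)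
      then have "q1 \<le> y" unfolding y_def by (rule cSup_upper[OF _ bdd])
      moreover have "y \<le> q2"
        unfolding y_def by (rule cSup_least) (use \<open>q1 \<in> Q\<close> Q_less pq in force)+
      moreover have "G.side n i q1 = G.side n i q2" if "i \<le> l" for i
        using eq[of i] pq that by (simp add: matches_def)
      ultimately have "G.side n l y = G.side n l q1"
        using pq by (intro G.side_convex[OF assms(1), of q1 q2 y l]) (auto simp: matches_def)
      then show ?thesis
        using eq[of l] pq \<open>q1 \<le> y\<close> \<open>y \<le> q2\<close> by (auto simp: matches_def)
    qed
    then have "matches n x y" using assms by (simp add: matches_def)
    then show ?thesis ..
  qed
qed

lemma match_unique:
  assumes "n \<ge> 1" "matches n x y" "matches n x y'"
  shows "y = y'"
  using G.side_injective[OF assms(1) dense_G] assms by (metis matches_def)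

end

section \<open>Order preserving conjugacies\<close>

lemma strict_mono_onto_interval_continuous:
  fixes h :: "real \<Rightarrow> real"
  assumes mono: "strict_mono_on {a..b} h" and onto: "h ` {a..b} = {a'..b'}"
  shows "continuous_on {a..b} h"
  unfolding continuous_on
proof (intro ballI order_tendstoI)
  fix x l assume x: "x \<in> {a..b}"
  then have hx: "h x \<in> {a'..b'}" using onto by blast
  have in_ab: "\<forall>\<^sub>F z in at x within {a..b}. z \<in> {a..b}"
    by (simp add: eventually_at_filter)
  show "\<forall>\<^sub>F z in at x within {a..b}. l < h z" if "l < h x"
  proof (cases "l < a'")
    case True
    from in_ab show ?thesis by eventually_elim (use True onto in force)
  next
    case False
    with that hx have "l \<in> h ` {a..b}" unfolding onto by auto
    then obtain w where w: "w \<in> {a..b}" "h w = l" by blast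
    with that x have "w < x"
      using strict_mono_on_leD[OF mono, of x w] by fastforce
    from in_ab order_tendstoD(1)[OF tendsto_ident_at this] show ?thesis
      by eventually_elim (use w strict_mono_onD[OF mono] in blast)
  qed
  show "\<forall>\<^sub>F z in at x within {a..b}. h z < l" if "h x < l"
  proof (cases "b' < l")
    case True
    from in_ab show ?thesis by eventually_elim (use True onto in force)
  next
    case False
    with that hx have "l \<in> h ` {a..b}" unfolding onto by auto
    then obtain w where w: "w \<in> {a..b}" "h w = l" by blast
    with that x have "x < w"
      using strict_mono_on_leD[OF mono, of w x] by fastforce
    from in_ab order_tendstoD(2)[OF tendsto_ident_at this] show ?thesis
      by eventually_elim (use w strict_mono_onD[OF mono] in blast)
  qed
qed

locale conjugate_systems = system_pair +
  fixes h k :: "nat \<Rightarrow> real \<Rightarrow> real"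
  assumes homeo: "\<And>n. n \<ge> 1 \<Longrightarrow> homeomorphism {a..b} {a'..b'} (h n) (k n)"
    and h_mono: "\<And>n. n \<ge> 1 \<Longrightarrow> strict_mono_on {a..b} (h n)"
    and h_F: "\<And>n x. n \<ge> 1 \<Longrightarrow> x \<in> {a..b} \<Longrightarrow> h (Suc n) (F n x) = G n (h n x)"
begin

lemma
  assumes "n \<ge> 1"
  shows h_in: "x \<in> {a..b} \<Longrightarrow> h n x \<in> {a'..b'}"
    and k_in: "y \<in> {a'..b'} \<Longrightarrow> k n y \<in> {a..b}"
    and k_h: "x \<in> {a..b} \<Longrightarrow> k n (h n x) = x"
    and h_k: "y \<in> {a'..b'} \<Longrightarrow> h n (k n y) = y"
  using homeo[OF assms] unfolding homeomorphism_def by blast+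

lemma h_less_iff:
  "n \<ge> 1 \<Longrightarrow> x \<in> {a..b} \<Longrightarrow> y \<in> {a..b} \<Longrightarrow> h n x < h n y \<longleftrightarrow> x < y"
  using strict_mono_onD[OF h_mono, of n] by (metis linorder_neqE order_less_asym order_less_irrefl)

lemma swapped: "conjugate_systems a' b' G a b F k h"
proof unfold_locales
  fix n :: nat assume n: "n \<ge> 1"
  show "homeomorphism {a'..b'} {a..b} (k n) (h n)"
    using homeo[OF n] by (rule homeomorphism_symD)
  show "strict_mono_on {a'..b'} (k n)"
    by (rule strict_mono_onI) (metis n h_less_iff h_k k_in)
  fix y assume "y \<in> {a'..b'}"
  then show "k (Suc n) (G n y) = F n (k n y)"
    using n h_F[OF n k_in[OF n], of y] k_h[of "Suc n" "F n (k n y)"] F.F_maps[OF n k_in[OF n]]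
    by (simp add: h_k)
qed

lemma h_iter:
  "n \<ge> 1 \<Longrightarrow> x \<in> {a..b} \<Longrightarrow> h (n + l) (nds_iter F n l x) = nds_iter G n l (h n x)"
proof (induction l)
  case (Suc l)
  then show ?case using h_F[of "n + l" "nds_iter F n l x"] F.iter_maps by simp
qed simp

text \<open>\<open>G n\<close> is \<open>F n\<close> in other increasing coordinates on both sides, so it is monotone on the images
  of the two branches of \<open>F n\<close>.\<close>

lemma h_crit: "n \<ge> 1 \<Longrightarrow> h n (F.crit n) = G.crit n"
proof -
  assume n: "n \<ge> 1"
  note c = F.crit_in[OF n]
  have c_in: "F.crit n \<in> {a..b}" using c by auto
  have ends: "a' \<le> h n a" "h n b \<le> b'"
    using h_in[OF n, of a] h_in[OF n, of b] F.a_less_b by auto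
  have less: "k n y1 < k n y2" if "y1 \<in> {a'..b'}" "y2 \<in> {a'..b'}" "y1 < y2" for y1 y2
    using that n by (metis h_less_iff h_k k_in)
  have G_eq: "G n y = h (Suc n) (F n (k n y))" if "y \<in> {a'..b'}" for y
    using that n by (simp add: h_F h_k k_in del: atLeastAtMost_iff)
  have G_less: "G n y1 < G n y2 \<longleftrightarrow> F n (k n y1) < F n (k n y2)"
    if "y1 \<in> {a'..b'}" "y2 \<in> {a'..b'}" for y1 y2
    using that n h_less_iff[of "Suc n"] F.F_maps[OF n] k_in[OF n] by (simp add: G_eq del: atLeastAtMost_iff)
  have le: "k n y \<le> F.crit n \<longleftrightarrow> y \<le> h n (F.crit n)" if "y \<in> {a'..b'}" for y
    using h_less_iff[OF n c_in k_in[OF n that]] h_k[OF n that] by auto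
  have hc: "h n (F.crit n) \<in> {a'<..<b'}"
    using h_less_iff[OF n, of a "F.crit n"] h_less_iff[OF n, of "F.crit n" b] c ends by auto
  have "is_turning_point a' b' (G n) (h n (F.crit n))"
    unfolding is_turning_point_def
  proof (intro conjI hc)
    show "strict_mono_on {a'..h n (F.crit n)} (G n)"
    proof (rule strict_mono_onI)
      fix y1 y2 assume y: "y1 \<in> {a'..h n (F.crit n)}" "y2 \<in> {a'..h n (F.crit n)}" "y1 < y2"
      then have "y1 \<in> {a'..b'}" "y2 \<in> {a'..b'}" using hc by auto
      with y show "G n y1 < G n y2"
        using less[of y1 y2] le k_in[OF n] strict_mono_onD[OF F.F_incr[OF n], of "k n y1" "k n y2"]
        by (auto simp: G_less)
    qed
    show "strict_antimono_on {h n (F.crit n)..b'} (G n)"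
    proof (rule monotone_onI)
      fix y1 y2 assume y: "y1 \<in> {h n (F.crit n)..b'}" "y2 \<in> {h n (F.crit n)..b'}" "y1 < y2"
      then have in_b: "y1 \<in> {a'..b'}" "y2 \<in> {a'..b'}" using hc by auto
      have "F.crit n \<le> k n y1" "F.crit n \<le> k n y2"
        using y in_b h_less_iff[OF n k_in[OF n] c_in] h_k[OF n] by (metis atLeastAtMost_iff not_le)+
      with y in_b show "G n y1 > G n y2"
        using less[of y1 y2] k_in[OF n] monotone_onD[OF F.F_decr[OF n], of "k n y1" "k n y2"]
        by (auto simp: G_less)
    qed
  qed
  then show ?thesis by (simp add: turning_point_eq)
qed

lemma hit_k:
  assumes "n \<ge> 1" "y \<in> {a'..b'}" "nds_iter G n l y = G.crit (n + l)"
  shows "nds_iter F n l (k n y) = F.crit (n + l)"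
proof -
  have "h (n + l) (nds_iter F n l (k n y)) = h (n + l) (F.crit (n + l))"
    using assms by (simp add: h_iter k_in h_k h_crit del: atLeastAtMost_iff)
  then show ?thesis
    using assms(1) k_h[of "n + l"] F.iter_maps[OF _ k_in[OF _ assms(2)]] F.crit_in[of "n + l"]
    by (metis atLeastAtMost_iff greaterThanLessThan_iff less_imp_le trans_le_add1)
qed

lemma side_h:
  assumes "n \<ge> 1" "x \<in> {a..b}"
  shows "G.side n l (h n x) = F.side n l x"
proof -
  have "sgn (h m z - h m w) = sgn (z - w)" if "m \<ge> 1" "z \<in> {a..b}" "w \<in> {a..b}" for m z w
    using h_less_iff[OF that] h_less_iff[OF that(1,3,2)] by (auto simp: sgn_if)
  from this[of "n + l" "nds_iter F n l x" "F.crit (n + l)"] show ?thesis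
    using assms F.iter_maps[OF assms] F.crit_in[of "n + l"]
    by (simp add: F.side_def G.side_def h_iter h_crit)
qed

end

lemma (in same_kneading) ex_conjugacy: "\<exists>h k. conjugate_systems a b F a' b' G h k"
proof -
  interpret swap: same_kneading a' b' G a b F
  proof unfold_locales
    show "system_pair.matches a' b' G a b F n (G.crit n) (F.crit n)" if "n \<ge> 1" for n
      using crit_matches[OF that] by (simp add: matches_def system_pair.matches_def system_pair_def
          F.unimodal_system_axioms G.unimodal_system_axioms)
  qed (rule dense_F dense_G; assumption)+
  have swap_matches: "swap.matches n y x \<longleftrightarrow> matches n x y" for n x y
    by (auto simp: matches_def swap.matches_def)
  define h where "h n x = (THE y. matches n x y)" for n x
  have h: "matches n x (h n x)" if "n \<ge> 1" "x \<in> {a..b}" for n x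
    unfolding h_def by (rule theI') (use has_match[OF that] match_unique[OF that(1)] in blast)
  have mono: "strict_mono_on {a..b} (h n)" if "n \<ge> 1" for n
    by (rule strict_mono_onI) (use matches_less[OF that h h] that in blast)
  have onto: "h n ` {a..b} = {a'..b'}" if n: "n \<ge> 1" for n
  proof (intro equalityI subsetI)
    fix y assume "y \<in> {a'..b'}"
    then obtain x where x: "matches n x y"
      using swap.has_match[OF n] by (auto simp: swap_matches)
    then have "x \<in> {a..b}" "y = h n x"
      using match_unique[OF n x h[OF n]] by (auto simp: matches_def)
    then show "y \<in> h n ` {a..b}" by blast
  qed (use h[OF n] in \<open>auto simp: matches_def\<close>)
  have "\<exists>k. homeomorphism {a..b} {a'..b'} (h n) k" if "n \<ge> 1" for n
    using strict_mono_onto_interval_continuous[OF mono[OF that] onto[OF that]] onto[OF that]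
      strict_mono_on_imp_inj_on[OF mono[OF that]]
    by (intro homeomorphism_compact) auto
  then obtain k where k: "\<And>n. n \<ge> 1 \<Longrightarrow> homeomorphism {a..b} {a'..b'} (h n) (k n)"
    by metis
  have "conjugate_systems a b F a' b' G h k"
  proof unfold_locales
    fix n :: nat and x assume n: "n \<ge> 1" and x: "x \<in> {a..b}"
    have "matches (Suc n) (F n x) (h (Suc n) (F n x))"
      using h F.F_maps n x by simp
    moreover have "matches (Suc n) (F n x) (G n (h n x))"
      using matches_shift[OF n h[OF n x]] .
    ultimately show "h (Suc n) (F n x) = G n (h n x)"
      using match_unique by (metis le_add1 plus_1_eq_Suc)
  qed (use k mono in auto)
  then show ?thesis by blast
qed

section \<open>Systems that converge to a unimodal map\<close>

lemma nds_iter_const: "nds_iter (\<lambda>_. f) n l = f ^^ l"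
  by (induction l) auto

locale limit_system = unimodal_system +
  fixes f :: "real \<Rightarrow> real"
  assumes f_unimodal: "unimodal a b f"
    and nonperiodic: "\<And>m. m \<ge> 1 \<Longrightarrow> (f ^^ m) (turning_point a b f) \<noteq> turning_point a b f"
    and F_lim: "uniform_limit {a..b} F f sequentially"
    and dense_f: "{a..b} \<subseteq> closure (precritical_map a b f)"
begin

sublocale lim: unimodal_system a b "\<lambda>_. f"
  using a_less_b f_unimodal by unfold_locales (simp add: UNDS_def)

abbreviation c :: real where
  "c \<equiv> turning_point a b f"

lemma c_in: "c \<in> {a<..<b}"
  using lim.crit_in[of 1] by simp

lemma lim_side: "lim.side n l x = sgn ((f ^^ l) x - c)"
  by (simp add: lim.side_def nds_iter_const)

lemma f_iter_maps: "x \<in> {a..b} \<Longrightarrow> (f ^^ l) x \<in> {a..b}"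
  using lim.iter_maps[of 1 x l] by (simp add: nds_iter_const)

lemma f_iter_cont: "continuous_on {a..b} (f ^^ l)"
  using lim.iter_cont[of 1 l] by (simp add: nds_iter_const)

lemma F_tendsto: "x \<in> {a..b} \<Longrightarrow> (\<lambda>n. F n x) \<longlonglongrightarrow> f x"
  by (rule tendsto_uniform_limitI[OF F_lim])

text \<open>
  The value of \<open>f\<close> at \<open>c\<close> strictly exceeds its values at the two points at distance \<open>e\<close> from \<open>c\<close>.
  For large \<open>n\<close> the same holds for \<open>F n\<close>, and monotonicity of the branches then confines the turning
  point of \<open>F n\<close> between these two points.
\<close>

lemma crit_tendsto: "crit \<longlonglongrightarrow> c"
proof (rule LIMSEQ_I)
  fix r :: real assume "r > 0"
  define e where "e = min r (min (c - a) (b - c)) / 2"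
  have e: "e > 0" "e < r" "c - e \<in> {a..b}" "c + e \<in> {a..b}"
    using \<open>r > 0\<close> c_in by (auto simp: e_def min_def field_simps)
  have c: "c \<in> {a..b}" using c_in by auto
  have below: "\<forall>\<^sub>F n in sequentially. F n z - F n c < 0" if "z \<in> {a..b}" "z \<noteq> c" for z
    using order_tendstoD(2)[OF tendsto_diff[OF F_tendsto[OF that(1)] F_tendsto[OF c]], of 0]
      lim.F_less_max[of 1 z] that by simp
  have "c - e \<noteq> c" "c + e \<noteq> c" using e by auto
  from below[OF e(3) this(1)] below[OF e(4) this(2)] have "\<forall>\<^sub>F n in sequentially. norm (crit n - c) < r"
    using eventually_ge_at_top[of 1]
  proof eventually_elim
    case (elim n)
    have "crit n < c + e"
      using elim strict_mono_onD[OF F_incr, of n c "c + e"] e c by force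
    moreover have "c - e < crit n"
      using elim monotone_onD[OF F_decr, of n "c - e" c] e c by force
    ultimately show ?case using e by (simp add: abs_less_iff)
  qed
  then show "\<exists>no. \<forall>n\<ge>no. norm (crit n - c) < r"
    by (simp add: eventually_sequentially)
qed

lemma crit_shift_tendsto: "(\<lambda>n. crit (n + l)) \<longlonglongrightarrow> c"
  by (rule LIMSEQ_ignore_initial_segment[OF crit_tendsto])

lemma iter_uniform_limit:
  "uniform_limit {a..b} (\<lambda>n. nds_iter F n l) (f ^^ l) sequentially"
proof (induction l)
  case 0
  then show ?case by (simp add: uniform_limit_iff)
next
  case (Suc l)
  show ?case
    unfolding uniform_limit_iff
  proof (intro allI impI)
    fix e :: real assume "e > 0"
    have "uniformly_continuous_on {a..b} f"
      using f_unimodal by (intro compact_uniformly_continuous) (auto simp: unimodal_def)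
    then obtain d where d: "d > 0"
      "\<And>x y. x \<in> {a..b} \<Longrightarrow> y \<in> {a..b} \<Longrightarrow> dist y x < d \<Longrightarrow> dist (f y) (f x) < e / 2"
      unfolding uniformly_continuous_on_def using \<open>e > 0\<close> by (meson half_gt_zero)
    have "\<forall>\<^sub>F n in sequentially. \<forall>x\<in>{a..b}. dist (F n x) (f x) < e / 2"
      using F_lim \<open>e > 0\<close> unfolding uniform_limit_iff by (meson half_gt_zero)
    then have "\<forall>\<^sub>F n in sequentially. \<forall>x\<in>{a..b}. dist (F (n + l) x) (f x) < e / 2"
      by (rule sequentially_offset)
    moreover have "\<forall>\<^sub>F n in sequentially. \<forall>x\<in>{a..b}. dist (nds_iter F n l x) ((f ^^ l) x) < d"
      using Suc \<open>d > 0\<close> unfolding uniform_limit_iff by simp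
    ultimately show "\<forall>\<^sub>F n in sequentially.
        \<forall>x\<in>{a..b}. dist (nds_iter F n (Suc l) x) ((f ^^ Suc l) x) < e"
      using eventually_ge_at_top[of 1]
    proof eventually_elim
      case (elim n)
      show ?case
      proof
        fix x assume x: "x \<in> {a..b}"
        have "dist (F (n + l) (nds_iter F n l x)) (f (nds_iter F n l x)) < e / 2"
          using elim iter_maps x by blast
        moreover have "dist (f (nds_iter F n l x)) (f ((f ^^ l) x)) < e / 2"
          using elim d(2)[OF f_iter_maps[OF x] iter_maps] x by blast
        ultimately show "dist (nds_iter F n (Suc l) x) ((f ^^ Suc l) x) < e"
          unfolding nds_iter.simps funpow.simps comp_apply dist_real_def by linarith
      qed
    qed
  qed
qed

text \<open>
  A common zero of \<open>f\<^sup>l - c\<close> and \<open>f\<^sup>m - c\<close> would make \<open>c\<close> periodic. By compactness the two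
  functions are never small together, and this persists for the nearby iterates of \<open>F n\<close>.
\<close>

lemma hits_separated:
  assumes "l \<noteq> m"
  shows "\<exists>d>0. \<forall>\<^sub>F n in sequentially. \<forall>p\<in>{a..b}. \<forall>q\<in>{a..b}.
    nds_iter F n l p = crit (n + l) \<longrightarrow> nds_iter F n m q = crit (n + m) \<longrightarrow> d \<le> \<bar>p - q\<bar>"
proof -
  define w where "w = (\<lambda>z. \<bar>(f ^^ l) z - c\<bar> + \<bar>(f ^^ m) z - c\<bar>)"
  have no_common: False if "i < j" "(f ^^ i) z = c" "(f ^^ j) z = c" for i j z
  proof -
    have "(f ^^ (j - i)) c = (f ^^ j) z"
      using that by (metis add.commute comp_apply funpow_add le_add_diff_inverse less_imp_le)
    then show False using nonperiodic[of "j - i"] that by simp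
  qed
  have w_pos: "w z > 0" for z
  proof -
    have "(f ^^ l) z \<noteq> c \<or> (f ^^ m) z \<noteq> c"
      using no_common assms by (metis linorder_neqE)
    then show ?thesis by (auto simp: w_def)
  qed
  have "continuous_on {a..b} w"
    unfolding w_def by (intro continuous_intros f_iter_cont)
  then obtain z0 where z0: "\<And>z. z \<in> {a..b} \<Longrightarrow> w z0 \<le> w z"
    using continuous_attains_inf[of "{a..b}" w] a_less_b by (metis atLeastAtMost_iff compact_Icc empty_iff less_imp_le order_refl)
  \<comment> \<open>Five error terms, each below \<open>e\<close>, separate \<open>w\<close> at a near-common hit from zero.\<close>
  define e where "e = w z0 / 5"
  have e: "e > 0" "\<And>z. z \<in> {a..b} \<Longrightarrow> 5 * e \<le> w z"
    using w_pos z0 by (auto simp: e_def)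
  have "uniformly_continuous_on {a..b} (f ^^ m)"
    by (rule compact_uniformly_continuous[OF f_iter_cont compact_Icc])
  then obtain d where d: "d > 0" "\<And>x y. x \<in> {a..b} \<Longrightarrow> y \<in> {a..b} \<Longrightarrow> dist y x < d \<Longrightarrow>
      dist ((f ^^ m) y) ((f ^^ m) x) < e"
    unfolding uniformly_continuous_on_def using \<open>e > 0\<close> by meson
  have near_iter: "\<forall>\<^sub>F n in sequentially. \<forall>z\<in>{a..b}. dist (nds_iter F n i z) ((f ^^ i) z) < e" for i
    using iter_uniform_limit[of i] \<open>e > 0\<close> unfolding uniform_limit_iff by simp
  have near_crit: "\<forall>\<^sub>F n in sequentially. dist (crit (n + i)) c < e" for i
    using tendstoD[OF crit_shift_tendsto \<open>e > 0\<close>] .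
  have "\<forall>\<^sub>F n in sequentially. \<forall>p\<in>{a..b}. \<forall>q\<in>{a..b}.
    nds_iter F n l p = crit (n + l) \<longrightarrow> nds_iter F n m q = crit (n + m) \<longrightarrow> d \<le> \<bar>p - q\<bar>"
    using near_iter[of l] near_iter[of m] near_crit[of l] near_crit[of m]
  proof eventually_elim
    case (elim n)
    show ?case
    proof (intro ballI impI, rule ccontr)
      fix p q assume pq: "p \<in> {a..b}" "q \<in> {a..b}" "\<not> d \<le> \<bar>p - q\<bar>"
        and hits: "nds_iter F n l p = crit (n + l)" "nds_iter F n m q = crit (n + m)"
      have "dist ((f ^^ m) p) ((f ^^ m) q) < e"
        using d(2)[of q p] pq by (simp add: dist_real_def)
      moreover have "dist (crit (n + l)) ((f ^^ l) p) < e" "dist (crit (n + m)) ((f ^^ m) q) < e"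
        using elim(1,2) pq hits by force+
      ultimately have "w p < 5 * e"
        using elim(3,4) unfolding w_def dist_real_def by linarith
      with e(2) pq show False by force
    qed
  qed
  with d show ?thesis by blast
qed

text \<open>
  At a first hit the iterate \<open>f\<^sup>l\<close> is strictly monotone nearby, so it crosses the level \<open>c\<close>, and
  the intermediate value theorem gives a crossing for the iterates of \<open>F\<close> from each late level.
\<close>

lemma first_hit_persists:
  assumes p: "p \<in> {a<..<b}" "u < p" "p < v"
    and hit: "lim.side 1 l p = 0" and first: "\<And>i. i < l \<Longrightarrow> lim.side 1 i p \<noteq> 0"
  shows "\<forall>\<^sub>F n in sequentially. \<exists>q\<in>{u<..<v} \<inter> {a..b}. nds_iter F n l q = crit (n + l)"
proof -
  obtain u' v' where uv: "max a u < u'" "u' < p" "p < v'" "v' < min b v"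
    and agree: "\<And>z i. u' \<le> z \<Longrightarrow> z \<le> v' \<Longrightarrow> i < l \<Longrightarrow> lim.side 1 i z = lim.side 1 i p"
    using lim.side_eq_nearby[OF le_refl p(1) first p(2,3)] by blast
  have sgn_end: "sgn ((f ^^ l) z - c) = lim.orient 1 l p * sgn (z - p)" if "u' \<le> z" "z \<le> v'" for z
  proof -
    have "(f ^^ l) p = c" using hit by (simp add: lim_side sgn_0_0)
    then show ?thesis
      using lim.sgn_iter_diff[of 1 p z l] agree[OF that] uv that p(1) by (simp add: nds_iter_const)
  qed
  have "lim.orient 1 l p \<noteq> 0" using lim.orient_nonzero[OF first] .
  then have neg: "((f ^^ l) u' - c) * ((f ^^ l) v' - c) < 0"
    using sgn_end[of u'] sgn_end[of v'] uv
    by (simp add: sgn_if zero_less_mult_iff mult_less_0_iff split: if_splits)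
  have "(\<lambda>n. nds_iter F n l z) \<longlonglongrightarrow> (f ^^ l) z" if "z \<in> {a..b}" for z
    by (rule tendsto_uniform_limitI[OF iter_uniform_limit that])
  then have "(\<lambda>n. (nds_iter F n l u' - crit (n + l)) * (nds_iter F n l v' - crit (n + l)))
      \<longlonglongrightarrow> ((f ^^ l) u' - c) * ((f ^^ l) v' - c)"
    using uv p(1) by (intro tendsto_intros crit_shift_tendsto) auto
  from order_tendstoD(2)[OF this neg] show ?thesis
    using eventually_ge_at_top[of 1]
  proof eventually_elim
    case (elim n)
    have cont: "continuous_on {u'..v'} (nds_iter F n l)"
      by (rule continuous_on_subset[OF iter_cont[OF elim(2)]]) (use uv in auto)
    have "nds_iter F n l u' < crit (n + l) \<and> crit (n + l) < nds_iter F n l v' \<or>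
        nds_iter F n l v' < crit (n + l) \<and> crit (n + l) < nds_iter F n l u'"
      using elim(1) by (auto simp: mult_less_0_iff)
    then obtain q where "u' \<le> q" "q \<le> v'" "nds_iter F n l q = crit (n + l)"
      using IVT'[OF _ _ _ cont, of "crit (n + l)"] IVT2'[OF _ _ _ cont, of "crit (n + l)"] uv by force
    then show ?case using uv by (intro bexI[of _ q]) auto
  qed
qed

lemma ex_first_hit:
  assumes "a \<le> u" "u < v" "v \<le> b"
  obtains p l where "u < p" "p < v" "lim.side 1 l p = 0" "\<And>i. i < l \<Longrightarrow> lim.side 1 i p \<noteq> 0"
proof -
  have "precritical a b (\<lambda>_. f) 1 = precritical_map a b f"
    by (simp add: precritical_def precritical_map_def nds_iter_const)
  then obtain p where p: "p \<in> precritical a b (\<lambda>_. f) 1" "u < p" "p < v"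
    using lim.precritical_between[of 1] dense_f assms by metis
  then obtain l where "lim.side 1 l p = 0" "\<And>i. i < l \<Longrightarrow> lim.side 1 i p \<noteq> 0"
    using exists_least_iff[of "\<lambda>l. lim.side 1 l p = 0"] by (auto simp: lim.precritical_iff_side)
  with p that show ?thesis by blast
qed

text \<open>
  Close to a point whose first hit is at time \<open>l\<close>, all points have the same first \<open>l\<close> sides, so no other
  point there can have a first hit at time \<open>l\<close>.
\<close>

lemma two_hitting_times:
  assumes "a \<le> u" "u < v" "v \<le> b"
  shows "\<exists>l m. l \<noteq> m \<and> (\<forall>\<^sub>F n in sequentially. \<exists>p\<in>{u<..<v}. \<exists>q\<in>{u<..<v}.
    nds_iter F n l p = crit (n + l) \<and> nds_iter F n m q = crit (n + m))"
proof -
  obtain p l where p: "u < p" "p < v" "lim.side 1 l p = 0" "\<And>i. i < l \<Longrightarrow> lim.side 1 i p \<noteq> 0"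
    using ex_first_hit[OF assms] by blast
  have p_in: "p \<in> {a<..<b}" using p assms by auto
  obtain u' v' where "max a u < u'" "u' < p" and v': "p < v'" "v' < min b v"
    and near: "\<And>z i. u' \<le> z \<Longrightarrow> z \<le> v' \<Longrightarrow> i < l \<Longrightarrow> lim.side 1 i z = lim.side 1 i p"
    using lim.side_eq_nearby[OF le_refl p_in p(4) p(1,2)] by blast
  have agree: "lim.side 1 i z = lim.side 1 i p" if "p \<le> z" "z \<le> v'" "i < l" for z i
    using near[of z i] that \<open>u' < p\<close> by simp
  obtain q m where q: "p < q" "q < v'" "lim.side 1 m q = 0" "\<And>i. i < m \<Longrightarrow> lim.side 1 i q \<noteq> 0"
    using ex_first_hit[of p v'] v' p_in by auto
  have "l \<noteq> m"
  proof
    assume "l = m"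
    have "p = q"
      by (rule lim.first_hit_unique[of 1 _ _ l]) (use p q v' p_in agree[of q] \<open>l = m\<close> in auto)
    with q show False by simp
  qed
  moreover have "\<forall>\<^sub>F n in sequentially. \<exists>p\<in>{u<..<v}. \<exists>q\<in>{u<..<v}.
    nds_iter F n l p = crit (n + l) \<and> nds_iter F n m q = crit (n + m)"
  proof -
    have "q \<in> {a<..<b}" "u < q" "q < v" using p_in q v' p(1) by auto
    then have "\<forall>\<^sub>F n in sequentially. \<exists>z\<in>{u<..<v} \<inter> {a..b}. nds_iter F n m z = crit (n + m)"
      by (rule first_hit_persists[OF _ _ _ q(3,4)])
    moreover have "\<forall>\<^sub>F n in sequentially. \<exists>z\<in>{u<..<v} \<inter> {a..b}. nds_iter F n l z = crit (n + l)"
      by (rule first_hit_persists[OF p_in p])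
    ultimately show ?thesis by eventually_elim blast
  qed
  ultimately show ?thesis by blast
qed

end

section \<open>Conjugacies between convergent systems are equicontinuous\<close>

locale conjugate_limit_systems =
  conjugate_systems a b F a' b' G h k + F: limit_system a b F f + G: limit_system a' b' G g
  for a b F a' b' G h k f g
begin

text \<open>
  A cell of the target contains hits of \<open>G\<close> with two different hitting times. The conjugacy
  takes them to hits of \<open>F\<close> with the same two times, which stay apart.
\<close>

lemma preimage_of_cell_wide:
  assumes "a' \<le> u" "u < v" "v \<le> b'"
  shows "\<exists>d>0. \<forall>\<^sub>F n in sequentially. \<forall>x\<in>{a..b}. \<forall>y\<in>{a..b}.
    h n x \<le> u \<longrightarrow> v \<le> h n y \<longrightarrow> d \<le> y - x"
proof -
  obtain l m where "l \<noteq> m" and G_hits: "\<forall>\<^sub>F n in sequentially. \<exists>p\<in>{u<..<v}. \<exists>q\<in>{u<..<v}.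
      nds_iter G n l p = G.crit (n + l) \<and> nds_iter G n m q = G.crit (n + m)"
    using G.two_hitting_times[OF assms] by blast
  from F.hits_separated[OF \<open>l \<noteq> m\<close>] obtain d where "d > 0" and F_hits:
    "\<forall>\<^sub>F n in sequentially. \<forall>p\<in>{a..b}. \<forall>q\<in>{a..b}.
      nds_iter F n l p = F.crit (n + l) \<longrightarrow> nds_iter F n m q = F.crit (n + m) \<longrightarrow> d \<le> \<bar>p - q\<bar>"
    by blast
  from G_hits F_hits eventually_ge_at_top[of 1]
  have "\<forall>\<^sub>F n in sequentially. \<forall>x\<in>{a..b}. \<forall>y\<in>{a..b}. h n x \<le> u \<longrightarrow> v \<le> h n y \<longrightarrow> d \<le> y - x"
  proof eventually_elim
    case (elim n)
    obtain p q where p: "p \<in> {u<..<v}" "nds_iter G n l p = G.crit (n + l)"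
      and q: "q \<in> {u<..<v}" "nds_iter G n m q = G.crit (n + m)"
      using elim(1) by blast
    have in_b: "p \<in> {a'..b'}" "q \<in> {a'..b'}" using p q assms by auto
    have d: "d \<le> \<bar>k n p - k n q\<bar>"
      using elim(2) hit_k[OF elim(3)] p q in_b k_in[OF elim(3)] by blast
    show ?case
    proof (intro ballI impI)
      fix x y assume xy: "x \<in> {a..b}" "y \<in> {a..b}" "h n x \<le> u" "v \<le> h n y"
      have "x < k n z \<and> k n z < y" if "z \<in> {u<..<v}" "z \<in> {a'..b'}" for z
        using h_less_iff[OF elim(3) xy(1) k_in[OF elim(3) that(2)]]
          h_less_iff[OF elim(3) k_in[OF elim(3) that(2)] xy(2)] h_k[OF elim(3) that(2)] that(1) xy
        by auto
      from this[of p] this[of q] show "d \<le> y - x" using d p q in_b by auto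
    qed
  qed
  with \<open>d > 0\<close> show ?thesis by blast
qed

text \<open>
  Any two values at distance \<open>e\<close> have between them one of the finitely many cells of a
  grid of mesh \<open>e / 2\<close>.
\<close>

lemma eventually_equicontinuous:
  assumes "e > 0"
  shows "\<exists>d>0. \<forall>\<^sub>F n in sequentially. \<forall>x\<in>{a..b}. \<forall>y\<in>{a..b}. \<bar>x - y\<bar> < d \<longrightarrow> \<bar>h n x - h n y\<bar> < e"
proof -
  define u where "u j = a' + real j * (e / 2)" for j
  define S where "S = {j. u (Suc j) \<le> b'}"
  define wide where "wide d n j \<longleftrightarrow>
    (\<forall>x\<in>{a..b}. \<forall>y\<in>{a..b}. h n x \<le> u j \<longrightarrow> u (Suc j) \<le> h n y \<longrightarrow> d \<le> y - x)" for d n j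
  have "S \<subseteq> {..nat \<lceil>(b' - a') / (e / 2)\<rceil>}"
  proof
    fix j assume "j \<in> S"
    then have "real j \<le> (b' - a') / (e / 2)"
      using assms by (simp add: S_def u_def field_simps)
    then show "j \<in> {..nat \<lceil>(b' - a') / (e / 2)\<rceil>}" by simp linarith
  qed
  then have fin: "finite S" by (rule finite_subset) simp
  have "\<exists>d>0. \<forall>\<^sub>F n in sequentially. wide d n j" if "j \<in> S" for j
    unfolding wide_def by (rule preimage_of_cell_wide) (use that assms in \<open>auto simp: S_def u_def\<close>)
  then obtain d where d: "\<And>j. j \<in> S \<Longrightarrow> d j > 0"
    "\<And>j. j \<in> S \<Longrightarrow> \<forall>\<^sub>F n in sequentially. wide (d j) n j"
    by metis
  define d0 where "d0 = Min (insert 1 (d ` S))"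
  have d0: "d0 > 0" "\<And>j. j \<in> S \<Longrightarrow> d0 \<le> d j"
    using fin d(1) by (auto simp: d0_def)
  have "\<forall>\<^sub>F n in sequentially. \<forall>j\<in>S. wide (d j) n j"
    by (rule eventually_ball_finite[OF fin]) (use d(2) in blast)
  then have "\<forall>\<^sub>F n in sequentially. \<forall>x\<in>{a..b}. \<forall>y\<in>{a..b}. \<bar>x - y\<bar> < d0 \<longrightarrow> \<bar>h n x - h n y\<bar> < e"
    using eventually_ge_at_top[of 1]
  proof eventually_elim
    case (elim n)
    have far: "d0 \<le> y - x" if "x \<in> {a..b}" "y \<in> {a..b}" "e \<le> h n y - h n x" for x y
    proof -
      define j where "j = nat \<lceil>(h n x - a') / (e / 2)\<rceil>"
      have hx: "a' \<le> h n x" "h n y \<le> b'"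
        using h_in[OF elim(2)] that by auto
      then have "real j = of_int \<lceil>(h n x - a') / (e / 2)\<rceil>"
        using assms by (simp add: j_def)
      then have "(h n x - a') / (e / 2) \<le> real j" "real j < (h n x - a') / (e / 2) + 1"
        by linarith+
      then have "h n x \<le> u j" "u (Suc j) \<le> h n x + e"
        using assms by (simp_all add: u_def field_simps)
      with that hx have "j \<in> S" "h n x \<le> u j" "u (Suc j) \<le> h n y"
        by (auto simp: S_def)
      then show ?thesis
        using elim(1) d0(2) that(1,2) unfolding wide_def by fastforce
    qed
    show ?case
    proof (intro ballI impI, rule ccontr)
      fix x y assume "x \<in> {a..b}" "y \<in> {a..b}" "\<bar>x - y\<bar> < d0" "\<not> \<bar>h n x - h n y\<bar> < e"
      then show False using far[of x y] far[of y x] by linarith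
    qed
  qed
  with d0(1) show ?thesis by blast
qed

lemma h_equicontinuous: "equicontinuous_on {1..} {a..b} h"
  unfolding equicontinuous_on_def
proof (intro ballI allI impI)
  fix x e :: real assume x: "x \<in> {a..b}" and "e > 0"
  obtain d N where "d > 0" and late: "\<And>n y. n \<ge> N \<Longrightarrow> y \<in> {a..b} \<Longrightarrow> \<bar>y - x\<bar> < d \<Longrightarrow> \<bar>h n y - h n x\<bar> < e"
    using eventually_equicontinuous[OF \<open>e > 0\<close>] x unfolding eventually_sequentially by blast
  have "\<forall>\<^sub>F y in at x within {a..b}. \<forall>n\<in>{1..<N}. dist (h n y) (h n x) < e"
  proof (rule eventually_ball_finite)
    show "\<forall>n\<in>{1..<N}. \<forall>\<^sub>F y in at x within {a..b}. dist (h n y) (h n x) < e"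
    proof
      fix n assume "n \<in> {1..<N}"
      then have "continuous_on {a..b} (h n)"
        using homeo by (simp add: homeomorphism_def)
      then show "\<forall>\<^sub>F y in at x within {a..b}. dist (h n y) (h n x) < e"
        using x \<open>e > 0\<close> by (auto simp: continuous_on intro: tendstoD)
    qed
  qed simp
  then obtain d' where "d' > 0" and early: "\<And>n y. n \<in> {1..<N} \<Longrightarrow> y \<in> {a..b} \<Longrightarrow> y \<noteq> x \<Longrightarrow> dist y x < d' \<Longrightarrow>
      dist (h n y) (h n x) < e"
    unfolding eventually_at by blast
  show "\<exists>d>0. \<forall>n\<in>{1..}. \<forall>y\<in>{a..b}. dist y x < d \<longrightarrow> dist (h n y) (h n x) < e"
  proof (intro exI[of _ "min d d'"] conjI ballI impI)
    fix n :: nat and y assume "n \<in> {1..}" "y \<in> {a..b}" "dist y x < min d d'"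
    then show "dist (h n y) (h n x) < e"
      using late[of n y] early[of n y] \<open>e > 0\<close>
      by (cases "n \<ge> N"; cases "y = x") (auto simp: dist_real_def)
  qed (use \<open>d > 0\<close> \<open>d' > 0\<close> in simp)
qed

end

section \<open>Kneading sequences classify\<close>

lemma kneading_sequence_eq_iff:
  assumes "unimodal_system a b F" "unimodal_system a' b' G"
  shows "kneading_sequence a b F = kneading_sequence a' b' G \<longleftrightarrow>
    (\<forall>n\<ge>1. \<forall>l. unimodal_system.side a b F n l (turning_point a b (F n)) =
      unimodal_system.side a' b' G n l (turning_point a' b' (G n)))"
proof -
  have "kneading_sequence a b F = kneading_sequence a' b' G \<longleftrightarrow>
    (\<forall>n\<ge>1. itinerary a b F n (turning_point a b (F n)) =
      itinerary a' b' G n (turning_point a' b' (G n)))"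
    by (force simp: kneading_sequence_def restrict_def fun_eq_iff)
  then show ?thesis by (simp add: itinerary_eq_iff_side_eq[OF assms])
qed

theorem theorem1p1:
  fixes aF bF aG bG :: real and F G :: "nat \<Rightarrow> real \<Rightarrow> real"
  assumes "UNDS aF bF F" and "UNDS aG bG G"
    and "limit_property aF bF F" and "limit_property aG bG G"
  shows "topologically_conjugate aF bF F aG bG G \<longleftrightarrow>
         kneading_sequence aF bF F = kneading_sequence aG bG G"
proof
  interpret system_pair aF bF F aG bG G
    by unfold_locales (fact assms)+
  note kneading_iff = kneading_sequence_eq_iff[OF F.unimodal_system_axioms G.unimodal_system_axioms]
  have crit_in: "F.crit n \<in> {aF..bF}" "G.crit n \<in> {aG..bG}" if "n \<ge> 1" for n
    using F.crit_in[OF that] G.crit_in[OF that] by auto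
  {
    assume "topologically_conjugate aF bF F aG bG G"
    then obtain h k where "conjugate_systems aF bF F aG bG G h k"
      unfolding topologically_conjugate_def conjugate_systems_def conjugate_systems_axioms_def
      using system_pair_axioms by blast
    then interpret conjugate_systems aF bF F aG bG G h k .
    show "kneading_sequence aF bF F = kneading_sequence aG bG G"
      unfolding kneading_iff using side_h crit_in h_crit by metis
  }
  assume "kneading_sequence aF bF F = kneading_sequence aG bG G"
  then have "matches n (F.crit n) (G.crit n)" if "n \<ge> 1" for n
    using that crit_in by (simp add: kneading_iff matches_def)
  moreover obtain f where f: "limit_system aF bF F f"
      and "\<And>n. n \<ge> 1 \<Longrightarrow> {aF..bF} \<subseteq> closure (precritical aF bF F n)"
    using assms(3) F.unimodal_system_axioms
    by (auto simp: limit_property_def limit_system_def limit_system_axioms_def)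
  moreover obtain g where g: "limit_system aG bG G g"
      and "\<And>n. n \<ge> 1 \<Longrightarrow> {aG..bG} \<subseteq> closure (precritical aG bG G n)"
    using assms(4) G.unimodal_system_axioms
    by (auto simp: limit_property_def limit_system_def limit_system_axioms_def)
  ultimately have "same_kneading aF bF F aG bG G"
    by unfold_locales
  then obtain h k where hk: "conjugate_systems aF bF F aG bG G h k"
    using same_kneading.ex_conjugacy by blast
  then interpret conjugate_systems aF bF F aG bG G h k .
  have "equicontinuous_on {1..} {aF..bF} h"
    using conjugate_limit_systems.h_equicontinuous[OF conjugate_limit_systems.intro[OF hk f g]] .
  moreover have "equicontinuous_on {1..} {aG..bG} k"
    using conjugate_limit_systems.h_equicontinuous[OF conjugate_limit_systems.intro[OF swapped g f]] .
  ultimately show "topologically_conjugate aF bF F aG bG G"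
    unfolding topologically_conjugate_def using homeo h_mono h_F by blast
qed

end
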